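(* Let $n\ge2$, $1\le p\le n$ and $1\le r\le n+1$. If $r\le n-p+1$ and $p\le n-1$, then $|\mathcal{T}_n^{(r,p)}|=\sum_{i=r}^{n}|\mathcal{T}_{n-1}^{(i,p)}|$. If $r>n-p+1$ and $p\ge2$, then $|\mathcal{T}_n^{(r,p)}|=\sum_{i=1}^{r-1}|\mathcal{T}_{n-1}^{(i,p-1)}|$.
   Context: For $m\ge1$, $1\le p\le m$: sites are $0,\dots,m+1$; a configuration in $\mathcal{S}(m,p)$ places $m+1$ distinct chips labeled $1,\dots,m+1$ with sites $0,m+1$ empty, one chip at each site of $\{1,\dots,m\}\setminus\{p\}$ and two chips at site $p$. Toppling: while some site holds at least two chips, choose such a site $i$ and two chips $\alpha<\beta$ there and move $\alpha$ to $i-1$, $\beta$ to $i+1$; it is known this terminates with at most one chip per site and the final configuration is independent of the choices. For $\pi\in S_m$, $r\in[m+1]$, $\pi^{(r,p)}$ places at site $i$ ($1\le i\le m$) chip $\pi_i$ if $\pi_i<r$ and $\pi_i+1$ otherwise, plus chip $r$ at site $p$. $\mathcal{T}_m^{(r,p)}$ is the set of $\pi\in S_m$ such that the final configuration of $\pi^{(r,p)}$, read left to right, is $1,2,\dots,m+1$. *)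

theory Defs
  imports "HOL-Combinatorics.Permutations"
begin

text \<open>A chip configuration: each (integer) site holds a finite set of distinct
  chips (labelled by natural numbers).\<close>
type_synonym config = "int \<Rightarrow> nat set"

definition topple_step :: "config \<Rightarrow> config \<Rightarrow> bool" where
  "topple_step c d \<longleftrightarrow>
     (\<exists>i \<alpha> \<beta>. \<alpha> \<in> c i \<and> \<beta> \<in> c i \<and> \<alpha> < \<beta> \<and>
        d = c(i := c i - {\<alpha>, \<beta>}, i - 1 := insert \<alpha> (c (i - 1)),
              i + 1 := insert \<beta> (c (i + 1))))"

definition stable :: "config \<Rightarrow> bool" where
  "stable c \<longleftrightarrow> (\<forall>i. finite (c i) \<and> card (c i) \<le> 1)"

text \<open>The final configuration reached by toppling until stable (known to exist
  and to be independent of the choices made).\<close>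
definition final_config :: "config \<Rightarrow> config" where
  "final_config c = (THE d. topple_step\<^sup>*\<^sup>* c d \<and> stable d)"

definition reading :: "nat \<Rightarrow> config \<Rightarrow> nat list" where
  "reading m c = concat (map (\<lambda>i. sorted_list_of_set (c (int i))) [0..<m+2])"

definition init_config :: "nat \<Rightarrow> nat \<Rightarrow> nat \<Rightarrow> (nat \<Rightarrow> nat) \<Rightarrow> config" where
  "init_config m r p \<pi> = (\<lambda>s.
     if 1 \<le> s \<and> s \<le> int m then
       {if \<pi> (nat s) < r then \<pi> (nat s) else \<pi> (nat s) + 1}
       \<union> (if s = int p then {r} else {})
     else {})"

definition T :: "nat \<Rightarrow> nat \<Rightarrow> nat \<Rightarrow> (nat \<Rightarrow> nat) set" where
  "T m r p = {\<pi>. \<pi> permutes {1..m} \<and>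
                  reading m (final_config (init_config m r p \<pi>)) = [1..<m+2]}"

end

theory Submission
  imports Defs
begin

text \<open>Put \<open>K = n + 1 - p\<close>. Let \<open>A s\<close> be the number of topplings at site \<open>s\<close> so far, plus
  \<open>max 0 (s - p)\<close>. Its increments stay in \<open>{0, 1}\<close>, the number of chips at \<open>s\<close> is one more than
  the second difference of \<open>A\<close> at \<open>s\<close>, and toppling at \<open>s\<close> increases \<open>A s\<close> by one. Hence
  sites with two chips are never adjacent, so topplings commute and the final configuration is
  unique. The property that every chip \<open>v\<close> at site \<open>s\<close> satisfies
  \<open>1 + A s \<le> v \<le> K + s - A s\<close> holds before a toppling if and only if it holds after it. In the
  final configuration \<open>A s = min s K\<close>, and there the property says that the chips are sorted.
  Reading it off the initial configuration, toppling sorts if and only if every chip \<open>v\<close> starting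
  at \<open>s\<close> satisfies \<open>s - p + 1 \<le> v \<le> s + K\<close>. Permutations with these
  restricted positions satisfy the recurrences: delete the entry at site \<open>r + p - 1\<close>,
  respectively \<open>r + p - n - 1\<close>, whose value \<open>i\<close> becomes the label of the extra chip.\<close>

section \<open>The odometer invariant and single topplings\<close>

text \<open>The increasing enumeration of all naturals except \<open>i\<close>. It serves both for
  labels avoiding the extra chip and for opening a gap among the values of a permutation, so that a
  deleted value can become a chip label.\<close>

definition skip :: "nat \<Rightarrow> nat \<Rightarrow> nat" where
  "skip i w = (if w < i then w else w + 1)"

text \<open>The values \<open>A s = s\<close> for \<open>s \<le> 0\<close> and \<open>A s = K\<close> for \<open>s > n\<close> make the height formula valid
  at the end sites \<open>0\<close> and \<open>n + 1\<close>, and prevent these from ever holding two chips.\<close>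

definition odometer_inv :: "nat \<Rightarrow> int \<Rightarrow> config \<Rightarrow> (int \<Rightarrow> int) \<Rightarrow> bool" where
  "odometer_inv n K c A \<longleftrightarrow>
     (\<forall>s\<le>0. A s = s) \<and> (\<forall>s\<ge>int n + 1. A s = K) \<and>
     (\<forall>s. A s \<le> A (s + 1) \<and> A (s + 1) \<le> A s + 1) \<and>
     (\<forall>s. finite (c s)) \<and> (\<forall>s. s < 0 \<or> s > int n + 1 \<longrightarrow> c s = {}) \<and>
     (\<forall>s. 0 \<le> s \<and> s \<le> int n + 1 \<longrightarrow> int (card (c s)) = A (s + 1) + A (s - 1) - 2 * A s + 1) \<and>
     (\<forall>s t. s \<noteq> t \<longrightarrow> c s \<inter> c t = {})"

lemma odometer_invI:
  assumes "\<And>s. s \<le> 0 \<Longrightarrow> A s = s" and "\<And>s. int n + 1 \<le> s \<Longrightarrow> A s = K"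
    and "\<And>s. A s \<le> A (s + 1) \<and> A (s + 1) \<le> A s + 1"
    and "\<And>s. finite (c s)" and "\<And>s. s < 0 \<or> s > int n + 1 \<Longrightarrow> c s = {}"
    and "\<And>s. 0 \<le> s \<Longrightarrow> s \<le> int n + 1 \<Longrightarrow>
      int (card (c s)) = A (s + 1) + A (s - 1) - 2 * A s + 1"
    and "\<And>s t. s \<noteq> t \<Longrightarrow> c s \<inter> c t = {}"
  shows "odometer_inv n K c A"
  unfolding odometer_inv_def
  using assms by (intro conjI allI impI) simp_all

definition chips_within :: "int \<Rightarrow> config \<Rightarrow> (int \<Rightarrow> int) \<Rightarrow> bool" where
  "chips_within K c A \<longleftrightarrow> (\<forall>s. \<forall>v\<in>c s. 1 + A s \<le> int v \<and> int v \<le> K + s - A s)"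

definition fire :: "int \<Rightarrow> nat \<Rightarrow> nat \<Rightarrow> config \<Rightarrow> config" where
  "fire i \<alpha> \<beta> c = (\<lambda>s. if s = i then c s - {\<alpha>, \<beta>} else if s = i - 1 then insert \<alpha> (c s)
     else if s = i + 1 then insert \<beta> (c s) else c s)"

lemma topple_step_iff_fire:
  "topple_step c d \<longleftrightarrow> (\<exists>i \<alpha> \<beta>. \<alpha> \<in> c i \<and> \<beta> \<in> c i \<and> \<alpha> < \<beta> \<and> d = fire i \<alpha> \<beta> c)"
proof -
  have "c(i := c i - {\<alpha>, \<beta>}, i - 1 := insert \<alpha> (c (i - 1)), i + 1 := insert \<beta> (c (i + 1)))
      = fire i \<alpha> \<beta> c" for i \<alpha> \<beta>
    by (auto simp: fire_def fun_eq_iff)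
  then show ?thesis by (simp add: topple_step_def)
qed

text \<open>The number of chips at \<open>i\<close> is one plus the increment of \<open>A\<close> to
  the right minus that to the left. Both increments are \<open>0\<close> or \<open>1\<close>, so two
  chips force right increment \<open>1\<close> and left increment \<open>0\<close>; the values of
  \<open>A\<close> beyond the ends contradict this at sites \<open>0\<close> and
  \<open>n + 1\<close>.\<close>

lemma firing_site:
  assumes inv: "odometer_inv n K c A" and ab: "\<alpha> \<in> c i" "\<beta> \<in> c i" "\<alpha> < \<beta>"
  shows "c i = {\<alpha>, \<beta>}" "1 \<le> i" "i \<le> int n" "A (i - 1) = A i" "A (i + 1) = A i + 1"
proof -
  have "\<not> (i < 0 \<or> i > int n + 1)"
    using inv ab(1) unfolding odometer_inv_def by (metis empty_iff)
  then have range: "0 \<le> i" "i \<le> int n + 1" by auto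
  have fin: "finite (c i)" using inv unfolding odometer_inv_def by blast
  have "card {\<alpha>, \<beta>} \<le> card (c i)" using ab fin by (intro card_mono) auto
  then have ge2: "2 \<le> card (c i)" using ab(3) by simp
  have card: "int (card (c i)) = A (i + 1) + A (i - 1) - 2 * A i + 1"
    using inv range unfolding odometer_inv_def by blast
  have steps: "A s \<le> A (s + 1) \<and> A (s + 1) \<le> A s + 1" for s
    using inv unfolding odometer_inv_def by blast
  show eqs: "A (i - 1) = A i" "A (i + 1) = A i + 1"
    using steps[of i] steps[of "i - 1"] card ge2 by auto
  have "card (c i) = 2" using card eqs by simp
  then show "c i = {\<alpha>, \<beta>}"
    using ab fin by (intro card_seteq[symmetric]) auto
  have "A 0 = 0" "A (-1) = -1" using inv unfolding odometer_inv_def by auto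
  then have "i \<noteq> 0" using eqs by auto
  with range show "1 \<le> i" by simp
  have "A (int n + 1 + 1) = K" "A (int n + 1) = K" using inv unfolding odometer_inv_def by auto
  then have "i \<noteq> int n + 1" using eqs by auto
  with range show "i \<le> int n" by simp
qed

text \<open>Raising \<open>A i\<close> turns the increments \<open>0\<close>, \<open>1\<close> on
  the two sides of \<open>i\<close> into \<open>1\<close>, \<open>0\<close>, and changes the second
  differences at \<open>i - 1\<close>, \<open>i\<close>, \<open>i + 1\<close> by \<open>1\<close>,
  \<open>-2\<close>, \<open>1\<close>, just as the numbers of chips change.\<close>

lemma odometer_inv_fire:
  assumes inv: "odometer_inv n K c A" and ab: "\<alpha> \<in> c i" "\<beta> \<in> c i" "\<alpha> < \<beta>"
  shows "odometer_inv n K (fire i \<alpha> \<beta> c) (A(i := A i + 1))"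
proof -
  note fs = firing_site[OF assms]
  have fin: "finite (c s)" for s using inv unfolding odometer_inv_def by blast
  have disj: "s \<noteq> t \<Longrightarrow> c s \<inter> c t = {}" for s t using inv unfolding odometer_inv_def by blast
  have steps: "A s \<le> A (s + 1) \<and> A (s + 1) \<le> A s + 1" for s
    using inv unfolding odometer_inv_def by blast
  have "\<alpha> \<notin> c (i - 1)" "\<beta> \<notin> c (i + 1)"
    using ab disj[of i "i - 1"] disj[of i "i + 1"] by auto
  then have card: "card (fire i \<alpha> \<beta> c s) = (if s = i then 0 else if s = i - 1 \<or> s = i + 1
      then card (c s) + 1 else card (c s))" for s
    using fs(1) fin by (auto simp: fire_def)
  have cardA: "int (card (c s)) = A (s + 1) + A (s - 1) - 2 * A s + 1"
    if "0 \<le> s" "s \<le> int n + 1" for s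
    using inv that unfolding odometer_inv_def by blast
  have A: "\<forall>s\<le>0. A s = s" "\<forall>s\<ge>int n + 1. A s = K"
    and empty: "\<forall>s. s < 0 \<or> s > int n + 1 \<longrightarrow> c s = {}"
    using inv unfolding odometer_inv_def by blast+
  let ?A = "A(i := A i + 1)"
  have 0: "?A s = s" if "s \<le> 0" for s using A that fs(2,3) by auto
  have 1: "?A s = K" if "int n + 1 \<le> s" for s using A that fs(2,3) by auto
  have 2: "?A s \<le> ?A (s + 1) \<and> ?A (s + 1) \<le> ?A s + 1" for s
    using steps[of s] fs(4,5) by (cases "s = i"; cases "s = i - 1") auto
  have 3: "int (card (fire i \<alpha> \<beta> c s)) = ?A (s + 1) + ?A (s - 1) - 2 * ?A s + 1"
    if "0 \<le> s" "s \<le> int n + 1" for s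
    using cardA[OF that] fs(4,5) unfolding card
    by (cases "s = i"; cases "s = i - 1"; cases "s = i + 1") auto
  have 4: "fire i \<alpha> \<beta> c s \<inter> fire i \<alpha> \<beta> c t = {}" if "s \<noteq> t" for s t
    using disj[OF that] disj[of s i] disj[of t i] ab that fs(1) by (auto simp: fire_def)
  have 5: "finite (fire i \<alpha> \<beta> c s)" for s using fin by (simp add: fire_def)
  have 6: "fire i \<alpha> \<beta> c s = {}" if "s < 0 \<or> s > int n + 1" for s
    using empty that fs(2,3) by (auto simp: fire_def)
  show ?thesis by (rule odometer_invI) (fact 0 1 2 3 4 5 6)+
qed

text \<open>The smaller of two distinct chips within an interval \<open>[L, U]\<close> lies in \<open>[L, U - 1]\<close> and
  the larger in \<open>[L + 1, U]\<close>, which are exactly the bounds at the neighbouring sites.\<close>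

lemma chips_within_fire:
  assumes inv: "odometer_inv n K c A" and ab: "\<alpha> \<in> c i" "\<beta> \<in> c i" "\<alpha> < \<beta>"
  shows "chips_within K (fire i \<alpha> \<beta> c) (A(i := A i + 1)) \<longleftrightarrow> chips_within K c A"
proof -
  note fs = firing_site[OF assms]
  let ?ok = "\<lambda>s v. 1 + A s \<le> int v \<and> int v \<le> K + s - A s"
  let ?ok' = "\<lambda>s v. 1 + (A(i := A i + 1)) s \<le> int v \<and> int v \<le> K + s - (A(i := A i + 1)) s"
  \<comment> \<open>Site \<open>i\<close> becomes empty and \<open>A\<close> changes only there, so
    the arrivals \<open>\<alpha>\<close> and \<open>\<beta>\<close> bring the only new
    conditions.\<close>
  have site: "(\<forall>v\<in>fire i \<alpha> \<beta> c s. ?ok' s v) \<longleftrightarrow> (s \<noteq> i \<longrightarrow> (\<forall>v\<in>c s. ?ok s v)) \<and>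
      (s = i - 1 \<longrightarrow> ?ok s \<alpha>) \<and> (s = i + 1 \<longrightarrow> ?ok s \<beta>)" for s
    by (cases "s = i"; cases "s = i - 1"; cases "s = i + 1") (auto simp: fire_def fs(1))
  have "chips_within K (fire i \<alpha> \<beta> c) (A(i := A i + 1)) \<longleftrightarrow>
      (\<forall>s. s \<noteq> i \<longrightarrow> (\<forall>v\<in>c s. ?ok s v)) \<and> ?ok (i - 1) \<alpha> \<and> ?ok (i + 1) \<beta>"
    unfolding chips_within_def site by (simp add: all_conj_distrib)
  also have "\<dots> \<longleftrightarrow> (\<forall>s. s \<noteq> i \<longrightarrow> (\<forall>v\<in>c s. ?ok s v)) \<and> ?ok i \<alpha> \<and> ?ok i \<beta>"
    using ab(3) fs(4,5) by auto
  also have "\<dots> \<longleftrightarrow> chips_within K c A"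
  proof -
    have "(\<forall>v\<in>c i. ?ok i v) \<longleftrightarrow> ?ok i \<alpha> \<and> ?ok i \<beta>" by (simp add: fs(1))
    then show ?thesis unfolding chips_within_def by metis
  qed
  finally show ?thesis .
qed

text \<open>The equivalence, rather than mere preservation, is what lets the final order be decided
  at the start.\<close>

lemma topple_steps_odometer:
  assumes "topple_step\<^sup>*\<^sup>* c d" and "odometer_inv n K c A"
  shows "\<exists>B. odometer_inv n K d B \<and> (chips_within K d B \<longleftrightarrow> chips_within K c A)"
  using assms
proof (induction rule: rtranclp_induct)
  case base
  then show ?case by blast
next
  case (step d e)
  then obtain B where B: "odometer_inv n K d B" "chips_within K d B \<longleftrightarrow> chips_within K c A"
    by blast
  from step(2) obtain i \<alpha> \<beta> where "\<alpha> \<in> d i" "\<beta> \<in> d i" "\<alpha> < \<beta>" "e = fire i \<alpha> \<beta> d"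
    unfolding topple_step_iff_fire by blast
  then show ?case using odometer_inv_fire[OF B(1)] chips_within_fire[OF B(1)] B(2) by blast
qed

section \<open>Confluence and termination of toppling\<close>

text \<open>A firing site holds exactly two chips, so distinct topplings act at distinct sites.
  These are not adjacent either, hence neither toppling touches the pair used by the other.\<close>

lemma topple_step_diamond:
  assumes inv: "odometer_inv n K c A" and "topple_step c d" and "topple_step c e" and "d \<noteq> e"
  shows "\<exists>f. topple_step d f \<and> topple_step e f"
proof -
  obtain i \<alpha> \<beta> where i: "\<alpha> \<in> c i" "\<beta> \<in> c i" "\<alpha> < \<beta>" and d: "d = fire i \<alpha> \<beta> c"
    using assms(2) unfolding topple_step_iff_fire by blast
  obtain j \<gamma> \<delta> where j: "\<gamma> \<in> c j" "\<delta> \<in> c j" "\<gamma> < \<delta>" and e: "e = fire j \<gamma> \<delta> c"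
    using assms(3) unfolding topple_step_iff_fire by blast
  note fi = firing_site[OF inv i] and fj = firing_site[OF inv j]
  have "i \<noteq> j"
  proof
    assume "i = j"
    then have "{\<alpha>, \<beta>} = {\<gamma>, \<delta>}" using fi(1) fj(1) by simp
    then have "\<alpha> = \<gamma> \<and> \<beta> = \<delta>" using i(3) j(3) by (auto simp: doubleton_eq_iff)
    then show False using assms(4) d e \<open>i = j\<close> by simp
  qed
  \<comment> \<open>Firing at \<open>i\<close> needs \<open>A\<close> to rise from \<open>i\<close>
    to \<open>i + 1\<close>; firing at \<open>i + 1\<close> needs it to be constant there.\<close>
  moreover have "j \<noteq> i + 1" "i \<noteq> j + 1" using fi(4,5) fj(4,5) by auto
  ultimately have far: "i \<noteq> j" "j \<noteq> i + 1" "i \<noteq> j + 1" "j \<noteq> i - 1" "i \<noteq> j - 1" by auto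
  \<comment> \<open>Sites at distance two share a neighbour, where the two insertions
    commute.\<close>
  have "fire j \<gamma> \<delta> d = fire i \<alpha> \<beta> e"
    unfolding d e fire_def fun_eq_iff using far by auto
  moreover have "d j = c j" "e i = c i" using far by (auto simp: d e fire_def)
  ultimately show ?thesis using i j unfolding topple_step_iff_fire by metis
qed

lemma stable_no_topple_step:
  assumes "stable c" shows "\<not> topple_step c d"
proof
  assume "topple_step c d"
  then obtain i \<alpha> \<beta> where "\<alpha> \<in> c i" "\<beta> \<in> c i" "\<alpha> < \<beta>" unfolding topple_step_def by blast
  moreover have "finite (c i)" "card (c i) \<le> 1" using assms unfolding stable_def by auto
  ultimately show False using card_le_Suc0_iff_eq[of "c i"] by auto
qed

text \<open>The diamond is pushed along the run to \<open>e\<close>: it joins the first step of the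
  run and the step to \<open>d\<close> at some \<open>f\<close>, and the induction hypothesis leads
  from \<open>f\<close> to \<open>e\<close>.\<close>

lemma topple_step_reaches_stable:
  assumes "topple_step\<^sup>*\<^sup>* c e" and "stable e" and "odometer_inv n K c A" and "topple_step c d"
  shows "topple_step\<^sup>*\<^sup>* d e"
  using assms
proof (induction arbitrary: d A rule: converse_rtranclp_induct)
  case base
  then show ?case using stable_no_topple_step by blast
next
  case (step c x)
  obtain B where B: "odometer_inv n K x B"
    using topple_steps_odometer[OF r_into_rtranclp[of topple_step, OF step(1)] step(5)] by blast
  show ?case
  proof (cases "x = d")
    case False
    then obtain f where "topple_step x f" "topple_step d f"
      using topple_step_diamond[OF step(5) step(1) step(6)] by blast
    with step.IH[OF step(4) B] show ?thesis by (meson converse_rtranclp_into_rtranclp)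
  qed (use step(2) in simp)
qed

text \<open>By the previous lemma every configuration on the run to \<open>d\<close> still reaches
  \<open>e\<close>; from the stable \<open>d\<close> this is possible only if
  \<open>d = e\<close>.\<close>

lemma stabilization_unique:
  assumes "topple_step\<^sup>*\<^sup>* c d" and "odometer_inv n K c A"
    and "stable d" and "topple_step\<^sup>*\<^sup>* c e" and "stable e"
  shows "d = e"
proof -
  have "topple_step\<^sup>*\<^sup>* d e" using assms(1)
  proof (induction rule: rtranclp_induct)
    case base
    then show ?case by (rule assms(4))
  next
    case (step y z)
    obtain B where "odometer_inv n K y B"
      using topple_steps_odometer[OF step(1) assms(2)] by blast
    then show ?case using topple_step_reaches_stable step assms(5) by blast
  qed
  then show ?thesis using stable_no_topple_step[OF assms(3)] by (auto elim: converse_rtranclpE)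
qed

lemma odometer_bounds:
  assumes "odometer_inv n K c A"
  shows "s \<le> t \<Longrightarrow> A t - A s \<le> t - s"
    and "A s \<le> K"
proof -
  have steps: "A s \<le> A (s + 1) \<and> A (s + 1) \<le> A s + 1" for s
    using assms unfolding odometer_inv_def by blast
  have *: "A s \<le> A t \<and> A t - A s \<le> t - s" if "s \<le> t" for s t
    using that
  proof (induction rule: int_ge_induct)
    case (step j)
    then show ?case using steps[of j] by simp
  qed simp
  show "s \<le> t \<Longrightarrow> A t - A s \<le> t - s" using * by blast
  have "A (max s (int n + 1)) = K" using assms unfolding odometer_inv_def by auto
  then show "A s \<le> K" using *[of s "max s (int n + 1)"] by simp
qed

text \<open>The total distance of \<open>A\<close> from its upper bound \<open>K\<close> on the
  sites \<open>1..n\<close> drops by one with each toppling and never becomes negative.\<close>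

lemma stabilization_exists:
  assumes "odometer_inv n K c A"
  shows "\<exists>d. topple_step\<^sup>*\<^sup>* c d \<and> stable d"
  using assms
proof (induction "nat (\<Sum>s=1..int n. K - A s)" arbitrary: c A rule: less_induct)
  case (less A c)
  show ?case
  proof (cases "stable c")
    case False
    have "finite (c s)" for s using less(2) unfolding odometer_inv_def by blast
    with False obtain i where "\<not> card (c i) \<le> 1" unfolding stable_def by blast
    then obtain \<alpha> \<beta> where "\<alpha> \<in> c i" "\<beta> \<in> c i" "\<alpha> \<noteq> \<beta>"
      using \<open>finite (c i)\<close> card_le_Suc0_iff_eq[of "c i"] by auto
    then obtain \<alpha> \<beta> where ab: "\<alpha> \<in> c i" "\<beta> \<in> c i" "\<alpha> < \<beta>" by (meson linorder_neqE_nat)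
    note fs = firing_site[OF less(2) ab] and inv = odometer_inv_fire[OF less(2) ab]
    let ?A = "A(i := A i + 1)"
    have "(\<Sum>s=1..int n. K - ?A s) < (\<Sum>s=1..int n. K - A s)"
      using fs(2,3) by (intro sum_strict_mono_ex1) auto
    \<comment> \<open>Nonnegativity makes the strict decrease survive the truncation by
      \<open>nat\<close>.\<close>
    moreover have "0 \<le> (\<Sum>s=1..int n. K - ?A s)"
      using odometer_bounds(2)[OF inv] by (intro sum_nonneg) (simp only: diff_ge_0_iff_ge)
    ultimately have "nat (\<Sum>s=1..int n. K - ?A s) < nat (\<Sum>s=1..int n. K - A s)" by linarith
    from less(1)[OF this inv] obtain d where "topple_step\<^sup>*\<^sup>* (fire i \<alpha> \<beta> c) d" "stable d" by blast
    moreover have "topple_step c (fire i \<alpha> \<beta> c)" using ab unfolding topple_step_iff_fire by blast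
    ultimately show ?thesis by (meson converse_rtranclp_into_rtranclp)
  qed blast
qed

lemma final_config:
  assumes "odometer_inv n K c A"
  shows "topple_step\<^sup>*\<^sup>* c (final_config c)" "stable (final_config c)"
proof -
  have "\<exists>!d. topple_step\<^sup>*\<^sup>* c d \<and> stable d"
  proof (rule ex_ex1I)
    show "\<exists>d. topple_step\<^sup>*\<^sup>* c d \<and> stable d" by (rule stabilization_exists[OF assms])
    show "d = e" if "topple_step\<^sup>*\<^sup>* c d \<and> stable d" "topple_step\<^sup>*\<^sup>* c e \<and> stable e" for d e
      using that by (elim conjE) (rule stabilization_unique[OF _ assms])
  qed
  from theI'[OF this] show "topple_step\<^sup>*\<^sup>* c (final_config c)" "stable (final_config c)"
    unfolding final_config_def by simp_all
qed

section \<open>The stable configuration\<close>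

text \<open>There are \<open>n + 2\<close> sites for \<open>n + 1\<close> chips; \<open>k\<close> is
  the one empty site, and chips to its left sit one site below their label.\<close>

definition sorted_config :: "nat \<Rightarrow> nat \<Rightarrow> config" where
  "sorted_config n k s = (if 0 \<le> s \<and> s < int k then {nat s + 1}
     else if int k < s \<and> s \<le> int n + 1 then {nat s} else {})"

lemma reading_sorted_config:
  assumes "k \<le> n + 1"
  shows "reading n (sorted_config n k) = [1..<n+2]"
proof -
  let ?f = "\<lambda>i. sorted_list_of_set (sorted_config n k (int i))"
  have "[0..<n+2] = [0..<k] @ [k] @ [k+1..<n+2]"
    using assms upt_add_eq_append[of 0 k "n + 2 - k"] upt_conv_Cons[of k "n + 2"] by simp
  then have "reading n (sorted_config n k)
      = concat (map ?f [0..<k]) @ ?f k @ concat (map ?f [k+1..<n+2])"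
    unfolding reading_def by simp
  also have "map ?f [0..<k] = map (\<lambda>i. [Suc i]) [0..<k]"
    by (auto simp: sorted_config_def)
  also have "map ?f [k+1..<n+2] = map (\<lambda>i. [i]) [k+1..<n+2]"
    by (auto simp: sorted_config_def)
  also have "?f k = []" by (simp add: sorted_config_def)
  also have "concat (map (\<lambda>i. [Suc i]) [0..<k]) = [1..<k+1]"
    using map_Suc_upt[of 0 k] by (simp add: concat_map_singleton)
  also have "concat (map (\<lambda>i. [i]) [k+1..<n+2]) = [k+1..<n+2]"
    using concat_map_singleton[of "\<lambda>i. i"] by simp
  also have "[1..<k+1] @ [] @ [k+1..<n+2] = [1..<n+2]"
    using assms upt_add_eq_append[of 1 "k+1" "n + 1 - k"] by simp
  finally show ?thesis .
qed

text \<open>With at most one chip per site, \<open>A\<close> is concave on \<open>0..n+1\<close>.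
  Its increments are therefore ones followed by zeros, so \<open>A\<close> climbs with slope one
  until it reaches its end value \<open>K\<close>.\<close>

lemma stable_odometer:
  assumes inv: "odometer_inv n K c A" and "stable c" and s: "0 \<le> s" "s \<le> int n + 1"
  shows "A s = min s K"
proof -
  have A0: "A 0 = 0" and An: "A (int n + 1) = K"
    using inv unfolding odometer_inv_def by auto
  have steps: "A s \<le> A (s + 1) \<and> A (s + 1) \<le> A s + 1" for s
    using inv unfolding odometer_inv_def by blast
  have concave: "A (s + 1) - A s \<le> A s - A (s - 1)" if "0 \<le> s" "s \<le> int n + 1" for s
  proof -
    have "int (card (c s)) = A (s + 1) + A (s - 1) - 2 * A s + 1"
      using inv that unfolding odometer_inv_def by blast
    moreover have "card (c s) \<le> 1" using assms(2) unfolding stable_def by blast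
    ultimately show ?thesis by linarith
  qed
  have rise: "s \<le> int n + 1 \<longrightarrow> A s = s \<or> A s = A (s - 1)" if "0 \<le> s" for s
    using that
  proof (induction rule: int_ge_induct)
    case (step j)
    then show ?case using steps[of j] concave[of j] by auto
  qed (simp add: A0)
  have flat: "t \<le> int n + 1 \<longrightarrow> A t = A s \<and> A t = A (t - 1)" if "s \<le> t" "A s = A (s - 1)" for t
    using that
  proof (induction rule: int_ge_induct)
    case (step j)
    then show ?case using steps[of j] concave[of j] s by auto
  qed simp
  have "A s \<le> s" using odometer_bounds(1)[OF inv s(1)] A0 by simp
  moreover have "A s \<le> K" by (rule odometer_bounds(2)[OF inv])
  \<comment> \<open>If the increment into \<open>s\<close> is zero, \<open>flat\<close> carries the
    value \<open>A s\<close> to site \<open>n + 1\<close>, where it is \<open>K\<close>.\<close>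
  moreover have "A s = s \<or> A s = K"
    using rise[OF s(1)] s flat[of "int n + 1"] An by auto
  ultimately show ?thesis by linarith
qed

text \<open>The bounds become \<open>s + 1 \<le> v \<le> k\<close> to the left of \<open>k\<close>
  and \<open>k + 1 \<le> v \<le> s\<close> to its right. With one chip per site this leaves only the
  sorted placement.\<close>

lemma stable_chips_within_iff:
  assumes inv: "odometer_inv n (int k) c A" and st: "stable c" and k: "k \<le> n + 1"
  shows "chips_within (int k) c A \<longleftrightarrow> reading n c = [1..<n+2]"
proof -
  note A = stable_odometer[OF inv st]
  \<comment> \<open>The end sites have neighbours \<open>-1\<close> and \<open>n + 2\<close>, which
    \<open>stable_odometer\<close> does not cover.\<close>
  have Aend: "A (-1) = -1" "A (2 + int n) = int k"
    using inv unfolding odometer_inv_def by auto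
  have empty: "c s = {}" if "s < 0 \<or> s > int n + 1" for s
    using inv that unfolding odometer_inv_def by blast
  have disj: "c s \<inter> c t = {}" if "s \<noteq> t" for s t
    using inv that unfolding odometer_inv_def by blast
  have card: "card (c s) = (if s = int k then 0 else 1)" if "0 \<le> s" "s \<le> int n + 1" for s
  proof -
    have "A (s + 1) = min (s + 1) (int k)"
      using A[of "s + 1"] Aend k that by (cases "s = int n + 1") auto
    moreover have "A (s - 1) = min (s - 1) (int k)"
      using A[of "s - 1"] Aend that by (cases "s = 0") auto
    moreover have "int (card (c s)) = A (s + 1) + A (s - 1) - 2 * A s + 1"
      using inv that unfolding odometer_inv_def by blast
    ultimately have "int (card (c s)) = (if s = int k then 0 else 1)"
      using A[OF that] by (simp add: min_def)
    then show ?thesis by (simp split: if_splits)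
  qed
  have fin: "finite (c s)" for s using inv unfolding odometer_inv_def by blast
  have ck: "c (int k) = {}" using card[of "int k"] k fin by simp
  have within: "chips_within (int k) c A \<longleftrightarrow> c = sorted_config n k"
  proof
    assume c: "c = sorted_config n k"
    show "chips_within (int k) c A"
      unfolding chips_within_def
    proof (intro allI ballI)
      fix s v assume "v \<in> c s"
      then have "0 \<le> s \<and> s < int k \<and> v = nat s + 1 \<or> int k < s \<and> s \<le> int n + 1 \<and> v = nat s"
        unfolding c sorted_config_def by (auto split: if_splits)
      then show "1 + A s \<le> int v \<and> int v \<le> int k + s - A s" using A[of s] k by auto
    qed
  next
    assume "chips_within (int k) c A"
    then have bd: "1 + A s \<le> int v" "int v \<le> int k + s - A s" if "v \<in> c s" for s v
      using that unfolding chips_within_def by blast+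
    have single: "\<exists>v. c s = {v}" if "0 \<le> s" "s \<le> int n + 1" "s \<noteq> int k" for s
      using card[OF that(1,2)] that(3) by (auto simp: card_1_singleton_iff)
    \<comment> \<open>Going down from \<open>k - 1\<close>: a chip \<open>v > s + 1\<close> at
      \<open>s\<close> would already sit at site \<open>v - 1\<close>.\<close>
    have left: "c s = {nat s + 1}" if "0 \<le> s" "s < int k" for s
      using that
    proof (induction "nat (int k - s)" arbitrary: s rule: less_induct)
      case less
      then obtain v where v: "c s = {v}" using single[of s] k by auto
      then have b: "s + 1 \<le> int v" "int v \<le> int k"
        using bd[of v s] A[of s] less(2,3) k by auto
      show ?case
      proof (rule ccontr)
        assume "c s \<noteq> {nat s + 1}"
        then have "s < int v - 1" using b v less(2) by auto
        then have "c (int v - 1) = {v}" using less(1)[of "int v - 1"] less(2) b by auto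
        then show False using disj[of s "int v - 1"] v \<open>s < int v - 1\<close> by auto
      qed
    qed
    \<comment> \<open>Going up from \<open>k + 1\<close>: a chip \<open>v < s\<close> at
      \<open>s\<close> would already sit at site \<open>v\<close>.\<close>
    have right: "c s = {nat s}" if "int k < s" "s \<le> int n + 1" for s
      using that
    proof (induction "nat s" arbitrary: s rule: less_induct)
      case less
      then obtain v where v: "c s = {v}" using single[of s] by auto
      then have b: "int k + 1 \<le> int v" "int v \<le> s"
        using bd[of v s] A[of s] less(2,3) k by auto
      show ?case
      proof (rule ccontr)
        assume "c s \<noteq> {nat s}"
        then have "int v < s" using b v by auto
        then have "c (int v) = {v}" using less(1)[of "int v"] less(3) b by auto
        then show False using disj[of s "int v"] v \<open>int v < s\<close> by auto
      qed
    qed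
    show "c = sorted_config n k"
      unfolding fun_eq_iff sorted_config_def using left right empty ck by force
  qed
  have "c = sorted_config n k" if "reading n c = reading n (sorted_config n k)"
  proof -
    \<comment> \<open>The reading forgets the sites, but the number of chips at each site is known,
      so the blocks of the concatenation can be recovered.\<close>
    have len: "card (c (int i)) = card (sorted_config n k (int i))" if "i < n + 2" for i
      using card[of "int i"] that by (auto simp: sorted_config_def)
    have "map (\<lambda>i. sorted_list_of_set (c (int i))) [0..<n+2]
        = map (\<lambda>i. sorted_list_of_set (sorted_config n k (int i))) [0..<n+2]"
      using that unfolding reading_def
      by (rule concat_injective) (auto simp: set_zip len simp del: upt_Suc)
    then have eq: "sorted_list_of_set (c (int i)) = sorted_list_of_set (sorted_config n k (int i))"
      if "i < n + 2" for i using that by (simp del: upt_Suc)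
    have fin': "finite (sorted_config n k s)" for s by (simp add: sorted_config_def)
    have "c s = sorted_config n k s" for s
    proof (cases "0 \<le> s \<and> s \<le> int n + 1")
      case True
      then have "sorted_list_of_set (c s) = sorted_list_of_set (sorted_config n k s)"
        using eq[of "nat s"] by (simp add: nat_less_iff)
      then show ?thesis using fin fin' by (rule sorted_list_of_set_inject)
    next
      case False
      then show ?thesis using empty[of s] k by (auto simp: sorted_config_def)
    qed
    then show ?thesis by blast
  qed
  then show ?thesis using within reading_sorted_config[OF k] by metis
qed

section \<open>The initial configuration and restricted positions\<close>

lemma init_config_eq:
  "init_config n r p \<pi> s = (if 1 \<le> s \<and> s \<le> int n
     then insert (skip r (\<pi> (nat s))) (if s = int p then {r} else {}) else {})"
  by (auto simp: init_config_def skip_def)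

lemma skip_neq: "skip i w \<noteq> i" and skip_inj: "skip i v = skip i w \<longleftrightarrow> v = w"
  by (auto simp: skip_def)

text \<open>On \<open>0..n+1\<close> this is \<open>max 0 (s - p)\<close>. The bend at
  \<open>p\<close> yields the two chips there; those at \<open>0\<close> and \<open>n + 1\<close>
  yield the empty end sites.\<close>

definition init_odometer :: "nat \<Rightarrow> nat \<Rightarrow> int \<Rightarrow> int" where
  "init_odometer n p s = (if s \<le> 0 then s else if s \<le> int p then 0
     else min (s - int p) (int n + 1 - int p))"

lemma odometer_inv_init:
  assumes "\<pi> permutes {1..n}" and "1 \<le> p" and "p \<le> n"
  shows "odometer_inv n (int (n + 1 - p)) (init_config n r p \<pi>) (init_odometer n p)"
proof -
  let ?c = "init_config n r p \<pi>" and ?A = "init_odometer n p"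
  have card: "card (?c s) = (if s = int p then 2 else if 1 \<le> s \<and> s \<le> int n then 1 else 0)" for s
    using assms by (auto simp: init_config_eq skip_neq)
  have disj: "?c s \<inter> ?c t = {}" if "s \<noteq> t" for s t
    using that skip_neq[of r] skip_neq[of r, symmetric]
    by (auto simp: init_config_eq skip_inj inj_eq[OF permutes_inj[OF assms(1)]])
  have heights: "int (card (?c s)) = ?A (s + 1) + ?A (s - 1) - 2 * ?A s + 1"
    if "0 \<le> s" "s \<le> int n + 1" for s
    unfolding card using that assms by (auto simp: init_odometer_def min_def)
  have steps: "?A s \<le> ?A (s + 1) \<and> ?A (s + 1) \<le> ?A s + 1" for s
    using assms by (auto simp: init_odometer_def min_def)
  have low: "?A s = s" if "s \<le> 0" for s using that by (simp add: init_odometer_def)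
  have high: "?A s = int (n + 1 - p)" if "int n + 1 \<le> s" for s
    using that assms by (auto simp: init_odometer_def of_nat_diff)
  have fin: "finite (?c s)" for s by (simp add: init_config_eq)
  have empty: "?c s = {}" if "s < 0 \<or> s > int n + 1" for s
    using that by (auto simp: init_config_eq)
  show ?thesis by (rule odometer_invI) (fact low high steps fin empty heights disj)+
qed

text \<open>All labels lie in \<open>1..n+1\<close>, so for \<open>s \<le> p\<close> the stated
  lower bound is automatic and for \<open>s > p\<close> the upper one is. This merges both cases
  into a single range; the chip \<open>r\<close> at \<open>p\<close> always satisfies its
  bounds.\<close>

lemma chips_within_init_iff:
  assumes "\<pi> permutes {1..n}" and "1 \<le> p" and "p \<le> n" and "1 \<le> r" and "r \<le> n + 1"
  shows "chips_within (int (n + 1 - p)) (init_config n r p \<pi>) (init_odometer n p) \<longleftrightarrow>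
    (\<forall>s\<in>{1..n}. skip r (\<pi> s) + p \<le> n + 1 + s \<and> s + 1 \<le> skip r (\<pi> s) + p)"
    (is "?L \<longleftrightarrow> (\<forall>s\<in>_. ?ok s)")
proof -
  let ?K = "int (n + 1 - p)" and ?A = "init_odometer n p"
  have ok: "1 + ?A (int s) \<le> int (skip r (\<pi> s)) \<and> int (skip r (\<pi> s)) \<le> ?K + int s - ?A (int s)
      \<longleftrightarrow> ?ok s" if "s \<in> {1..n}" for s
  proof -
    have "\<pi> s \<in> {1..n}" using that by (simp only: permutes_in_image[OF assms(1)])
    then have "1 \<le> skip r (\<pi> s)" "skip r (\<pi> s) \<le> n + 1" by (auto simp: skip_def)
    then show ?thesis using that assms(2,3) by (auto simp: init_odometer_def min_def of_nat_diff)
  qed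
  have r: "1 + ?A (int p) \<le> int r \<and> int r \<le> ?K + int p - ?A (int p)"
    using assms by (auto simp: init_odometer_def)
  have site: "(\<forall>v\<in>init_config n r p \<pi> s. 1 + ?A s \<le> int v \<and> int v \<le> ?K + s - ?A s) \<longleftrightarrow>
      (s \<in> {1..int n} \<longrightarrow> 1 + ?A s \<le> int (skip r (\<pi> (nat s))) \<and>
        int (skip r (\<pi> (nat s))) \<le> ?K + s - ?A s)" for s
    using r assms(2,3) by (auto simp: init_config_eq of_nat_diff)
  have "?L \<longleftrightarrow> (\<forall>s\<in>{1..int n}. 1 + ?A s \<le> int (skip r (\<pi> (nat s))) \<and>
      int (skip r (\<pi> (nat s))) \<le> ?K + s - ?A s)"
    unfolding chips_within_def site by blast
  also have "{1..int n} = int ` {1..n}" by (simp add: image_int_atLeastAtMost)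
  finally show ?thesis using ok by simp
qed

text \<open>Toppling disappears here: the condition on the final configuration is carried back along
  the run to the initial one.\<close>

lemma T_eq:
  assumes "1 \<le> p" and "p \<le> n" and "1 \<le> r" and "r \<le> n + 1"
  shows "T n r p = {\<pi>. \<pi> permutes {1..n} \<and>
    (\<forall>s\<in>{1..n}. skip r (\<pi> s) + p \<le> n + 1 + s \<and> s + 1 \<le> skip r (\<pi> s) + p)}"
proof -
  have "reading n (final_config (init_config n r p \<pi>)) = [1..<n+2] \<longleftrightarrow>
      chips_within (int (n + 1 - p)) (init_config n r p \<pi>) (init_odometer n p)"
    if "\<pi> permutes {1..n}" for \<pi>
  proof -
    note inv = odometer_inv_init[OF that assms(1,2), of r]
    from topple_steps_odometer[OF final_config(1)[OF inv] inv]
    obtain B where "odometer_inv n (int (n + 1 - p)) (final_config (init_config n r p \<pi>)) B"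
      "chips_within (int (n + 1 - p)) (final_config (init_config n r p \<pi>)) B \<longleftrightarrow>
       chips_within (int (n + 1 - p)) (init_config n r p \<pi>) (init_odometer n p)" by blast
    then show ?thesis using stable_chips_within_iff[OF _ final_config(2)[OF inv]] by force
  qed
  then show ?thesis unfolding T_def using chips_within_init_iff[OF _ assms] by blast
qed

section \<open>Inserting and deleting an entry of a permutation\<close>

text \<open>In one-line notation, the inverse of deleting the entry \<open>i\<close> at position
  \<open>t\<close> and standardising the rest.\<close>

definition insert_entry :: "nat \<Rightarrow> nat \<Rightarrow> (nat \<Rightarrow> nat) \<Rightarrow> nat \<Rightarrow> nat" where
  "insert_entry t i \<pi> s = (if s < t then skip i (\<pi> s) else if s = t then i else skip i (\<pi> (s - 1)))"

lemma permutes_of_inj_on: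
  assumes "finite S" and "inj_on f S" and "f ` S \<subseteq> S" and "\<And>x. x \<notin> S \<Longrightarrow> f x = x"
  shows "f permutes S"
  using assms by (intro bij_imp_permutes) (auto simp: bij_betw_def endo_inj_surj)

lemma insert_entry_permutes:
  assumes "\<pi> permutes {1..n}" and "t \<in> {1..n+1}" and "i \<in> {1..n+1}"
  shows "insert_entry t i \<pi> permutes {1..n+1}"
proof (rule permutes_of_inj_on)
  note inj = inj_eq[OF permutes_inj[OF assms(1)]]
  show "inj_on (insert_entry t i \<pi>) {1..n+1}"
    using skip_neq[of i] skip_neq[of i, symmetric]
    by (auto simp: inj_on_def insert_entry_def skip_inj inj split: if_splits)
  have mem: "skip i (\<pi> s) \<in> {1..n+1}" if "s \<in> {1..n}" for s
    using permutes_in_image[OF assms(1), of s] that assms(3) by (auto simp: skip_def)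
  show "insert_entry t i \<pi> ` {1..n+1} \<subseteq> {1..n+1}"
  proof clarify
    fix x assume x: "x \<in> {1..n+1}"
    consider "x < t" | "x = t" | "x > t" by linarith
    then show "insert_entry t i \<pi> x \<in> {1..n+1}"
    proof cases
      case 1
      then show ?thesis using mem[of x] x assms(2) by (simp add: insert_entry_def)
    next
      case 2
      then show ?thesis using assms(3) by (simp add: insert_entry_def)
    next
      case 3
      then have "x - 1 \<in> {1..n}" using x assms(2) by auto
      then show ?thesis using mem[of "x - 1"] 3 by (simp add: insert_entry_def)
    qed
  qed
  \<comment> \<open>At \<open>0\<close> nothing is shifted, since \<open>t\<close> and
    \<open>i\<close> are positive; beyond \<open>n + 1\<close> the shifts of position and value
    cancel.\<close>
  show "insert_entry t i \<pi> x = x" if "x \<notin> {1..n+1}" for x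
  proof (cases "x = 0")
    case True
    then show ?thesis using permutes_not_in[OF assms(1), of 0] assms(2,3)
      by (auto simp: insert_entry_def skip_def)
  next
    case False
    then have "n < x - 1" using that by auto
    then have "\<pi> (x - 1) = x - 1" by (intro permutes_not_in[OF assms(1)]) auto
    then show ?thesis using \<open>n < x - 1\<close> assms(2,3) by (auto simp: insert_entry_def skip_def)
  qed
qed simp

lemma permutes_delete_entry:
  assumes "\<sigma> permutes {1..n+1}" and "t \<in> {1..n+1}"
  obtains \<pi> where "\<pi> permutes {1..n}" and "\<sigma> = insert_entry t (\<sigma> t) \<pi>"
proof
  let ?i = "\<sigma> t"
  \<comment> \<open>The position in \<open>\<sigma>\<close> of the entry that moves to position
    \<open>s\<close> when position \<open>t\<close> is removed.\<close>
  let ?src = "\<lambda>s. if s < t then s else s + 1"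
  define \<pi> where "\<pi> s = (if \<sigma> (?src s) < ?i then \<sigma> (?src s) else \<sigma> (?src s) - 1)" for s
  note inj = inj_eq[OF permutes_inj[OF assms(1)]]
  have i: "?i \<in> {1..n+1}" using assms(2) by (simp only: permutes_in_image[OF assms(1)])
  have ne: "\<sigma> (?src s) \<noteq> ?i" for s by (simp add: inj)
  have skip: "skip ?i (\<pi> s) = \<sigma> (?src s)" for s using ne[of s] unfolding \<pi>_def skip_def by auto
  show "\<sigma> = insert_entry t ?i \<pi>"
    using assms(2) by (auto simp: fun_eq_iff insert_entry_def skip)
  show "\<pi> permutes {1..n}"
  proof (rule permutes_of_inj_on)
    show "inj_on \<pi> {1..n}"
    proof (rule inj_onI)
      fix x y assume "\<pi> x = \<pi> y"
      then have "\<sigma> (?src x) = \<sigma> (?src y)" using skip by metis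
      then show "x = y" by (auto simp: inj split: if_splits)
    qed
    show "\<pi> ` {1..n} \<subseteq> {1..n}"
    proof
      fix v assume "v \<in> \<pi> ` {1..n}"
      then obtain s where s: "s \<in> {1..n}" "v = \<pi> s" by blast
      then have "\<sigma> (?src s) \<in> {1..n+1}" by (subst permutes_in_image[OF assms(1)]) auto
      then show "v \<in> {1..n}" using ne[of s] i unfolding s(2) \<pi>_def by auto
    qed
    show "\<pi> x = x" if "x \<notin> {1..n}" for x
    proof -
      have "?src x \<notin> {1..n+1}" using that assms(2) by auto
      then have "\<sigma> (?src x) = ?src x" using permutes_not_in[OF assms(1)] by blast
      then show ?thesis using i that assms(2) unfolding \<pi>_def by auto
    qed
  qed simp
qed

text \<open>Permutations are classified by their value \<open>i\<close> at \<open>t\<close>, which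
  \<open>P t\<close> confines to \<open>I\<close>; deleting it is a bijection. \<open>Q\<close> is
  imposed on \<open>skip i (\<pi> s)\<close>, the value before standardisation, so each summand has
  the shape of \<open>T_eq\<close> with extra chip \<open>i\<close>.\<close>

lemma card_restricted_permutations_delete:
  fixes P Q :: "nat \<Rightarrow> nat \<Rightarrow> bool"
  assumes t: "t \<in> {1..n+1}" and I: "I \<subseteq> {1..n+1}"
    and Pt: "\<And>w. w \<in> {1..n+1} \<Longrightarrow> P t w \<longleftrightarrow> w \<in> I"
    and less: "\<And>s w. s \<in> {1..<t} \<Longrightarrow> w \<in> {1..n+1} \<Longrightarrow> P s w \<longleftrightarrow> Q s w"
    and greater: "\<And>s w. s \<in> {t..n} \<Longrightarrow> w \<in> {1..n+1} \<Longrightarrow> P (s + 1) w \<longleftrightarrow> Q s w"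
  shows "card {\<sigma>. \<sigma> permutes {1..n+1} \<and> (\<forall>s\<in>{1..n+1}. P s (\<sigma> s))}
    = (\<Sum>i\<in>I. card {\<pi>. \<pi> permutes {1..n} \<and> (\<forall>s\<in>{1..n}. Q s (skip i (\<pi> s)))})"
    (is "card ?S = (\<Sum>i\<in>I. card (?R i))")
proof -
  have finI: "finite I" using I finite_subset by blast
  have finR: "finite (?R i)" for i using finite_permutations[of "{1..n}"] by simp
  have P_iff: "(\<forall>s\<in>{1..n+1}. P s (insert_entry t i \<pi> s)) \<longleftrightarrow>
      i \<in> I \<and> (\<forall>s\<in>{1..n}. Q s (skip i (\<pi> s)))"
    if \<pi>: "\<pi> permutes {1..n}" and i: "i \<in> {1..n+1}" for i \<pi>
  proof -
    have mem: "skip i (\<pi> s) \<in> {1..n+1}" if "s \<in> {1..n}" for s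
      using permutes_in_image[OF \<pi>, of s] that by (auto simp: skip_def)
    have "Suc ` {t..n} = {t+1..n+1}" by (simp add: image_Suc_atLeastAtMost)
    then have split: "{1..n+1} = insert t ({1..<t} \<union> Suc ` {t..n})" using t by auto
    have "(\<forall>s\<in>{1..n+1}. P s (insert_entry t i \<pi> s)) \<longleftrightarrow> P t i \<and>
        (\<forall>s\<in>{1..<t}. P s (skip i (\<pi> s))) \<and> (\<forall>s\<in>{t..n}. P (s + 1) (skip i (\<pi> s)))"
      unfolding split ball_simps ball_Un by (simp add: insert_entry_def)
    also have "\<dots> \<longleftrightarrow> i \<in> I \<and> (\<forall>s\<in>{1..<t}. Q s (skip i (\<pi> s))) \<and> (\<forall>s\<in>{t..n}. Q s (skip i (\<pi> s)))"
      using Pt[OF i] less[OF _ mem] greater[OF _ mem] t by auto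
    also have "\<dots> \<longleftrightarrow> i \<in> I \<and> (\<forall>s\<in>{1..n}. Q s (skip i (\<pi> s)))"
      using t by (auto simp: not_less)
    finally show ?thesis .
  qed
  have "inj_on (\<lambda>(i, \<pi>). insert_entry t i \<pi>) (Sigma I ?R)"
  proof (rule inj_onI, clarify)
    fix i j \<pi> \<rho>
    assume eq: "insert_entry t i \<pi> = insert_entry t j \<rho>"
    have "i = j" using fun_cong[OF eq, of t] by (simp add: insert_entry_def)
    moreover have "\<pi> s = \<rho> s" for s
      using fun_cong[OF eq, of s] fun_cong[OF eq, of "s + 1"] \<open>i = j\<close>
      by (cases "s < t") (auto simp: insert_entry_def skip_inj)
    ultimately show "i = j \<and> \<pi> = \<rho>" by auto
  qed
  moreover have "(\<lambda>(i, \<pi>). insert_entry t i \<pi>) ` Sigma I ?R = ?S"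
  proof
    show "(\<lambda>(i, \<pi>). insert_entry t i \<pi>) ` Sigma I ?R \<subseteq> ?S"
    proof clarify
      fix i \<pi> assume i: "i \<in> I" and \<pi>: "\<pi> permutes {1..n}" "\<forall>s\<in>{1..n}. Q s (skip i (\<pi> s))"
      then show "insert_entry t i \<pi> permutes {1..n+1} \<and>
          (\<forall>s\<in>{1..n+1}. P s (insert_entry t i \<pi> s))"
        using P_iff[OF \<pi>(1)] insert_entry_permutes[OF \<pi>(1) t] I by blast
    qed
    show "?S \<subseteq> (\<lambda>(i, \<pi>). insert_entry t i \<pi>) ` Sigma I ?R"
    proof clarify
      fix \<sigma> assume \<sigma>: "\<sigma> permutes {1..n+1}" "\<forall>s\<in>{1..n+1}. P s (\<sigma> s)"
      obtain \<pi> where \<pi>: "\<pi> permutes {1..n}" "\<sigma> = insert_entry t (\<sigma> t) \<pi>"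
        using permutes_delete_entry[OF \<sigma>(1) t] .
      have "\<sigma> t \<in> {1..n+1}" using t by (simp only: permutes_in_image[OF \<sigma>(1)])
      from P_iff[OF \<pi>(1) this] have "(\<sigma> t, \<pi>) \<in> Sigma I ?R"
        unfolding \<pi>(2)[symmetric] using \<pi>(1) \<sigma>(2) by simp
      then show "\<sigma> \<in> (\<lambda>(i, \<pi>). insert_entry t i \<pi>) ` Sigma I ?R"
        using \<pi>(2) by (intro image_eqI[of _ _ "(\<sigma> t, \<pi>)"]) auto
    qed
  qed
  ultimately have "card ?S = card (Sigma I ?R)" by (metis (lifting) card_image)
  also have "\<dots> = (\<Sum>i\<in>I. card (?R i))" using finI finR by (intro card_SigmaI) auto
  finally show ?thesis .
qed

section \<open>The two recurrences\<close>

text \<open>At \<open>t = r + p - 1\<close> the lower bound on \<open>skip r w\<close> is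
  \<open>r\<close>, that is \<open>r \<le> w\<close>, and the upper bound is vacuous. At all other
  positions the bounds for the two sizes are equivalent: where they differ, both hold or both
  fail.\<close>

lemma T_recurrence_small:
  assumes "1 \<le> p" and "1 \<le> r" and "r + p \<le> n + 2" and "p \<le> n"
  shows "card (T (n + 1) r p) = (\<Sum>i = r..n+1. card (T n i p))"
proof -
  have "card (T (n + 1) r p) = (\<Sum>i = r..n+1. card {\<pi>. \<pi> permutes {1..n} \<and>
      (\<forall>s\<in>{1..n}. skip i (\<pi> s) + p \<le> n + 1 + s \<and> s + 1 \<le> skip i (\<pi> s) + p)})"
    using assms
    by (subst T_eq, simp_all only:,
        intro card_restricted_permutations_delete[where t = "r + p - 1" and
          P = "\<lambda>s w. skip r w + p \<le> n + 1 + 1 + s \<and> s + 1 \<le> skip r w + p" and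
          Q = "\<lambda>s w. w + p \<le> n + 1 + s \<and> s + 1 \<le> w + p"])
      (auto simp: skip_def)
  also have "\<dots> = (\<Sum>i = r..n+1. card (T n i p))"
    using assms by (intro sum.cong) (auto simp: T_eq)
  finally show ?thesis .
qed

text \<open>Now \<open>t = r + p - (n + 2)\<close> is the position whose upper bound on
  \<open>skip r w\<close> is \<open>r\<close>, that is \<open>w < r\<close>, while the lower bound
  is vacuous. Positions after \<open>t\<close> drop by one, and \<open>p\<close> drops with
  them.\<close>

lemma T_recurrence_large:
  assumes "2 \<le> p" and "n + 2 < r + p" and "r \<le> n + 2" and "p \<le> n + 1"
  shows "card (T (n + 1) r p) = (\<Sum>i = 1..r-1. card (T n i (p - 1)))"
proof -
  have "card (T (n + 1) r p) = (\<Sum>i = 1..r-1. card {\<pi>. \<pi> permutes {1..n} \<and>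
      (\<forall>s\<in>{1..n}. skip i (\<pi> s) + (p - 1) \<le> n + 1 + s \<and> s + 1 \<le> skip i (\<pi> s) + (p - 1))})"
    using assms
    by (subst T_eq, simp_all only:,
        intro card_restricted_permutations_delete[where t = "r + p - (n + 2)" and
          P = "\<lambda>s w. skip r w + p \<le> n + 1 + 1 + s \<and> s + 1 \<le> skip r w + p" and
          Q = "\<lambda>s w. w + (p - 1) \<le> n + 1 + s \<and> s + 1 \<le> w + (p - 1)"])
      (auto simp: skip_def)
  also have "\<dots> = (\<Sum>i = 1..r-1. card (T n i (p - 1)))"
    using assms by (intro sum.cong) (auto simp: T_eq)
  finally show ?thesis .
qed

theorem theorem4p8:
  fixes n p r :: nat
  assumes "n \<ge> 2" and "1 \<le> p" and "p \<le> n" and "1 \<le> r" and "r \<le> n + 1"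
  shows "(r \<le> n - p + 1 \<and> p \<le> n - 1 \<longrightarrow>
            card (T n r p) = (\<Sum>i = r..n. card (T (n - 1) i p)))
       \<and> (r > n - p + 1 \<and> p \<ge> 2 \<longrightarrow>
            card (T n r p) = (\<Sum>i = 1..r - 1. card (T (n - 1) i (p - 1))))"
  using assms T_recurrence_small[of p r "n - 1"] T_recurrence_large[of p "n - 1" r] by auto

end
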